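(* Let $p\ge 7$ be a prime and let $V$ be the curve defined over $\mathbb{F}_p$ in $\mathrm{PG}(p-2,\overline{\mathbb{F}}_p)$ by the equations $X_1^k+X_2^k+\cdots+X_{p-1}^k=0$ for $1\le k\le p-3$. Then $V$ has no proper $\mathbb{F}_{p^2}$-rational point, that is, $V(\mathbb{F}_{p^2})=V(\mathbb{F}_p)$.
   Context: $V(\mathbb{F}_{p^i})$ denotes the set of all points of $V$ lying in $\mathrm{PG}(p-2,\mathbb{F}_{p^i})$. *)

theory Defs
  imports "HOL-Algebra.Algebraic_Closure_Type" "HOL-Number_Theory.Residues" "HOL-Library.Cardinality"
begin

definition GF :: "nat \<Rightarrow> 'k::field set" where
  "GF q = (THE F. subfield F (ring_of_type_algebra :: 'k ring) \<and> card F = q)"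

text \<open>
  Homogeneous coordinates of points of \<open>PG(n, F)\<close>: they are numbered \<open>1, \<dots>, n + 1\<close>, and
  coordinate vectors are set to \<open>0\<close> at all other indices.
\<close>
definition hom_coords :: "nat \<Rightarrow> 'k::field set \<Rightarrow> (nat \<Rightarrow> 'k) set" where
  "hom_coords n F = {x. (\<forall>i\<in>{1..n+1}. x i \<in> F) \<and> (\<forall>i. i \<notin> {1..n+1} \<longrightarrow> x i = 0) \<and>
     (\<exists>i\<in>{1..n+1}. x i \<noteq> 0)}"

definition proj_point :: "(nat \<Rightarrow> 'k::field) \<Rightarrow> (nat \<Rightarrow> 'k) set" where
  "proj_point x = {y. \<exists>c. c \<noteq> 0 \<and> y = (\<lambda>i. c * x i)}"

text \<open>
  For a subfield \<open>F\<close> of the ambient field, \<open>PG n F\<close> is regarded as a subset of \<open>PG n UNIV\<close>: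
  a point is a class under scaling by the ambient field, and it lies in \<open>PG n F\<close> if some
  representative has all its coordinates in \<open>F\<close>.
\<close>
definition PG :: "nat \<Rightarrow> 'k::field set \<Rightarrow> (nat \<Rightarrow> 'k) set set" where
  "PG n F = proj_point ` hom_coords n F"

definition power_sum_curve :: "nat \<Rightarrow> (nat \<Rightarrow> 'k::field) set set" where
  "power_sum_curve p =
     {P \<in> PG (p - 2) UNIV. \<forall>x\<in>P. \<forall>k\<in>{1..p - 3}. (\<Sum>i = 1..p - 1. x i ^ k) = 0}"

lemma proj_point_mem_power_sum_curve:
  fixes x :: "nat \<Rightarrow> 'k::field"
  assumes "x \<in> hom_coords (p - 2) UNIV"
  shows "proj_point x \<in> power_sum_curve p \<longleftrightarrow>
     (\<forall>k\<in>{1..p - 3}. (\<Sum>i = 1..p - 1. x i ^ k) = 0)"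
proof -
  have "x \<in> proj_point x"
    unfolding proj_point_def by (auto intro!: exI[of _ 1])
  moreover have "(\<Sum>i = 1..p - 1. (c * x i) ^ k) = c ^ k * (\<Sum>i = 1..p - 1. x i ^ k)" for c k
    by (simp add: power_mult_distrib sum_distrib_left)
  ultimately show ?thesis
    using assms unfolding power_sum_curve_def PG_def by (auto simp: proj_point_def)
qed

lemma subfield_type_algebraD:
  fixes F :: "'k::field set"
  assumes "subfield F (ring_of_type_algebra :: 'k ring)"
  shows "0 \<in> F" "1 \<in> F" "\<And>x y. x \<in> F \<Longrightarrow> y \<in> F \<Longrightarrow> x * y \<in> F"
    "\<And>x. x \<in> F \<Longrightarrow> x \<noteq> 0 \<Longrightarrow> \<exists>y\<in>F. x * y = 1"
proof -
  interpret R: Ring.field "ring_of_type_algebra :: 'k ring"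
    by (rule field_from_type_algebra)
  note s = subfieldE[OF assms]
  show "0 \<in> F" "1 \<in> F" "\<And>x y. x \<in> F \<Longrightarrow> y \<in> F \<Longrightarrow> x * y \<in> F"
    using subringE(2,3,6)[OF s(1)] by (simp_all add: ring_of_type_algebra_def)
  show "\<exists>y\<in>F. x * y = 1" if "x \<in> F" "x \<noteq> 0" for x
    using R.subfield_m_inv(1,2)[OF assms, of x] that
    by (auto simp: ring_of_type_algebra_def)
qed

lemma subfield_type_algebraI:
  fixes F :: "'k::field set"
  assumes "1 \<in> F" "\<And>x y. x \<in> F \<Longrightarrow> y \<in> F \<Longrightarrow> x * y \<in> F"
    "\<And>x y. x \<in> F \<Longrightarrow> y \<in> F \<Longrightarrow> x + y \<in> F" "\<And>x. x \<in> F \<Longrightarrow> - x \<in> F"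
    "\<And>x. x \<in> F \<Longrightarrow> inverse x \<in> F"
  shows "subfield F (ring_of_type_algebra :: 'k ring)"
proof -
  let ?R = "ring_of_type_algebra :: 'k ring"
  interpret R: Ring.field ?R
    by (rule field_from_type_algebra)
  have [simp]: "carrier ?R = UNIV" "\<one>\<^bsub>?R\<^esub> = 1" "\<zero>\<^bsub>?R\<^esub> = 0"
    "x \<otimes>\<^bsub>?R\<^esub> y = x * y" "x \<oplus>\<^bsub>?R\<^esub> y = x + y" for x y
    by (simp_all add: ring_of_type_algebra_def)
  have neg: "\<ominus>\<^bsub>?R\<^esub> x = - x" for x
    using R.minus_equality[of "- x" x] by simp
  have inv: "inv\<^bsub>?R\<^esub> x = inverse x" if "x \<noteq> 0" for x
    using R.comm_inv_char[of x "inverse x"] that by simp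
  show ?thesis
    by (rule R.subfieldI', rule R.subringI) (use assms in \<open>auto simp: neg inv\<close>)
qed

lemma finite_subfield_power_eq:
  fixes F :: "'k::field set"
  assumes F: "subfield F (ring_of_type_algebra :: 'k ring)" and fin: "finite F" and x: "x \<in> F"
  shows "x ^ card F = x"
proof (cases "x = 0")
  case False
  note D = subfield_type_algebraD[OF F]
  obtain z where z: "z \<in> F" "x * z = 1"
    using D(4)[OF x False] by blast
  have z0: "z \<noteq> 0" using z by auto
  have "(\<Prod>y\<in>F-{0}. x * y) = x ^ (card F - 1) * \<Prod>(F-{0})"
    using D(1) fin by (simp add: prod.distrib)
  moreover have "(\<Prod>y\<in>F-{0}. x * y) = \<Prod>(F-{0})"
  proof (rule prod.reindex_bij_witness[of _ "\<lambda>y. z * y" "\<lambda>y. x * y"])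
    show "z * (x * a) = a" for a using z(2) by (metis mult.assoc mult.commute mult_1)
    show "x * (z * b) = b" for b using z(2) by (metis mult.assoc mult_1)
  qed (use False z z0 x D in auto)
  moreover have "\<Prod>(F-{0}) \<noteq> 0" using fin by simp
  ultimately have "x ^ (card F - 1) = 1" by simp
  moreover have "card F > 0" using D(1) fin card_gt_0_iff by blast
  ultimately show ?thesis by (metis Suc_diff_1 mult.right_neutral power_Suc)
next
  case True
  moreover have "card F > 0" using subfield_type_algebraD(1)[OF F] fin card_gt_0_iff by blast
  ultimately show ?thesis by simp
qed

lemma GF_unique_exists:
  assumes p: "Factorial_Ring.prime p" "CHAR('k::alg_closed_field) = p" and i: "i > 0"
  shows "subfield F (ring_of_type_algebra :: 'k ring) \<and> card F = p ^ i
     \<longleftrightarrow> F = {x. x ^ (p ^ i) = x}"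
proof -
  define q where "q = p ^ i"
  define S where "S = {x::'k. x ^ q = x}"
  define f where "f = monom (1::'k) q - monom 1 1"
  have p2: "p \<ge> 2" using p(1) prime_ge_2_nat by blast
  have q1: "q > 1" unfolding q_def using p2 i by (intro one_less_power) auto
  have deg: "degree f = q"
    unfolding f_def diff_conv_add_uminus using q1
    by (subst degree_add_eq_left) (auto simp: degree_monom_eq)
  have "(of_nat q :: 'k) = 0"
    using p(2) i unfolding q_def by (simp add: of_nat_eq_0_iff_char_dvd)
  hence der: "pderiv f = -1"
    by (simp add: f_def pderiv_diff pderiv_monom one_pCons monom_0)
  have f0: "f \<noteq> 0" using deg q1 by auto
  have roots: "S = {x. poly f x = 0}"
    by (auto simp: S_def f_def poly_monom)
  obtain A where A: "size A = degree f" "f = smult (lead_coeff f) (\<Prod>x\<in>#A. [:-x, 1:])"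
    using alg_closed_imp_factorization[OF f0] by blast
  have cnt: "count A a \<le> 1" for a
  proof (rule ccontr)
    assume "\<not> count A a \<le> 1"
    hence "{#a, a#} \<subseteq># A" by (simp add: subseteq_mset_def)
    then obtain B where "A = {#a, a#} + B" using mset_subset_eq_exists_conv by blast
    hence "\<exists>g. f = [:-a, 1:] * ([:-a, 1:] * g)"
      using A(2) by (metis (no_types, lifting) image_mset_add_mset mult_smult_right 
         prod_mset.add_mset add_mset_add_single union_mset_add_mset_left empty_neutral(1))
    then obtain g where "f = [:-a, 1:] * ([:-a, 1:] * g)" by blast
    hence "poly (pderiv f) a = 0" by (simp only: pderiv_mult poly_mult poly_add) simp
    with der show False by simp
  qed
  have "S = set_mset A"
  proof -
    have "poly (\<Prod>x\<in>#B. [:-x, 1:]) y = 0 \<longleftrightarrow> y \<in># B" for B and y :: 'k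
      by (induction B) auto
    moreover have "lead_coeff f \<noteq> 0" using f0 by simp
    ultimately show ?thesis
      unfolding roots by (subst A(2)) (auto simp del: leading_coeff_0_iff)
  qed
  moreover have "size A = card (set_mset A)"
    unfolding size_multiset_overloaded_eq
    using cnt by (metis (no_types, lifting) One_nat_def card_eq_sum count_greater_eq_one_iff
        le_antisym sum.cong)
  ultimately have cS: "card S = q" using A(1) deg by simp
  hence fS: "finite S" using q1 card.infinite by fastforce
  have sub: "subfield S (ring_of_type_algebra :: 'k ring)"
  proof (rule subfield_type_algebraI)
    have add: "(x + y) ^ q = x ^ q + y ^ q" for x y :: 'k
      using freshmans_dream'[of q i x y] p by (simp add: q_def)
    show "x + y \<in> S" if "x \<in> S" "y \<in> S" for x y
      using that add by (simp add: S_def)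
    show "- x \<in> S" if "x \<in> S" for x
    proof -
      have "(x + - x) ^ q = x ^ q + (- x) ^ q" by (rule add)
      hence "x ^ q + (- x) ^ q = 0" using q1 by (simp add: power_0_left)
      thus ?thesis using that by (simp add: S_def add_eq_0_iff)
    qed
  qed (auto simp: S_def power_mult_distrib power_inverse)
  show ?thesis unfolding q_def[symmetric] S_def[symmetric]
  proof
    assume F: "subfield F (ring_of_type_algebra :: 'k ring) \<and> card F = q"
    hence "finite F" using q1 card.infinite by fastforce
    hence "F \<subseteq> S" using finite_subfield_power_eq F by (auto simp: S_def)
    thus "F = S" using F cS fS by (simp add: card_subset_eq)
  qed (use sub cS in auto)
qed

text \<open>
  In particular, the definite description in the definition of \<open>GF\<close> is meaningful for all
  powers \<open>p ^ i\<close> over an algebraically closed field of characteristic \<open>p\<close>.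
\<close>
corollary GF_prime_power:
  assumes "Factorial_Ring.prime p" "CHAR('k::alg_closed_field) = p" "i > 0"
  shows "subfield (GF (p ^ i)) (ring_of_type_algebra :: 'k ring)" "card (GF (p ^ i) :: 'k set) = p ^ i"
    "(GF (p ^ i) :: 'k set) = {x. x ^ (p ^ i) = x}"
proof -
  show *: "(GF (p ^ i) :: 'k set) = {x. x ^ (p ^ i) = x}"
    unfolding GF_def GF_unique_exists[OF assms] by simp
  show "subfield (GF (p ^ i)) (ring_of_type_algebra :: 'k ring)" "card (GF (p ^ i) :: 'k set) = p ^ i"
    using GF_unique_exists[OF assms, of "GF (p ^ i)"] * by auto
qed

text \<open>
  A field with a prime number \<open>p\<close> of elements is a model of the prime field, and its image in
  its algebraic closure is \<open>GF p\<close>.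
\<close>
lemma CHAR_alg_closure_prime_field:
  assumes "Factorial_Ring.prime CARD('f::field)"
  shows "CHAR('f alg_closure) = CARD('f)"
proof -
  have "CHAR('f) dvd CARD('f)" by (rule CHAR_dvd_CARD)
  moreover have "CHAR('f) \<noteq> 1" by (metis of_nat_1 of_nat_CHAR zero_neq_one)
  ultimately have "CHAR('f) = CARD('f)" using assms by (metis prime_nat_iff)
  thus ?thesis by simp
qed

lemma GF_prime_field:
  assumes "Factorial_Ring.prime CARD('f::field)"
  shows "(GF CARD('f) :: 'f alg_closure set) = range to_ac"
proof -
  have "subfield (range to_ac) (ring_of_type_algebra :: 'f alg_closure ring)"
    by (rule subfield_type_algebraI)
      (auto simp flip: to_ac_add to_ac_mult to_ac_minus to_ac_inverse to_ac_1)
  moreover have "card (range (to_ac :: 'f \<Rightarrow> 'f alg_closure)) = CARD('f)"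
    by (rule card_image) (rule inj_to_ac)
  ultimately have "range (to_ac :: 'f \<Rightarrow> 'f alg_closure) = {x. x ^ (CARD('f) ^ 1) = x}"
    using GF_unique_exists[OF assms CHAR_alg_closure_prime_field[OF assms], of 1 "range to_ac"] by simp
  thus ?thesis
    using GF_prime_power(3)[OF assms CHAR_alg_closure_prime_field[OF assms], of 1] by simp
qed

end

theory Submission
  imports Defs "HOL-Computational_Algebra.Polynomial_FPS"
begin

text \<open>
  By Newton's identities, the inverses of the nonzero coordinates of a point of \<open>V\<close> are roots of
  a polynomial \<open>1 - a T^(p - 2) - b T^(p - 1)\<close>, so every coordinate satisfies \<open>x^p = a x^2 + b x\<close>.
  If \<open>a = 0\<close>, the ratio of any two nonzero coordinates is fixed by the Frobenius map, so the point
  has a representative over \<open>GF p\<close>. If \<open>a \<noteq> 0\<close> and the coordinates lie in \<open>GF (p^2)\<close>, then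
  iterating the relation and using \<open>x^(p^2) = x\<close> shows that all nonzero coordinates are roots of
  one cubic. But a Vandermonde argument shows that vanishing of the first \<open>p - 3 > 3\<close> power sums
  forces more than \<open>p - 3\<close> distinct nonzero coordinates.
\<close>

lemma poly_eq_sum_coeff:
  fixes q :: "'k::field poly"
  assumes "degree q \<le> m"
  shows "poly q y = (\<Sum>k\<le>m. coeff q k * y ^ k)"
  unfolding poly_altdef
  by (rule sum.mono_neutral_left) (use assms in \<open>auto simp: coeff_eq_0\<close>)

text \<open>Newton's identities as a logarithmic derivative: the factor 1 - x_i T contributes -x_i /
  (1 - x_i T), a geometric series whose coefficients are the powers of x_i, so the factors add up to
  the power sums.\<close>

lemma fps_deriv_prod_linear:
  fixes x :: "'a \<Rightarrow> 'k::field"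
  assumes "finite A"
  shows "fps_deriv (\<Prod>i\<in>A. 1 - fps_const (x i) * fps_X) =
    - (\<Prod>i\<in>A. 1 - fps_const (x i) * fps_X) * Abs_fps (\<lambda>n. \<Sum>i\<in>A. x i ^ Suc n)"
  using assms
proof (induction A)
  case empty
  show ?case by (simp add: fps_eq_iff)
next
  case (insert j A)
  define P where "P = (\<Prod>i\<in>A. 1 - fps_const (x i) * fps_X)"
  define G where "G = Abs_fps (\<lambda>n. \<Sum>i\<in>A. x i ^ Suc n)"
  define L where "L = 1 - fps_const (x j) * fps_X"
  define E where "E = Abs_fps (\<lambda>n. x j ^ Suc n)"
  have LE: "L * E = fps_const (x j)"
  proof (rule fps_ext)
    fix n show "(L * E) $ n = fps_const (x j) $ n"
      by (cases n) (simp_all add: L_def E_def algebra_simps mult.assoc)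
  qed
  have "fps_deriv (L * P) = - fps_const (x j) * P - L * (P * G)"
    using insert.IH by (simp add: P_def G_def L_def)
  also have "\<dots> = - (L * P) * (E + G)"
    unfolding LE[symmetric] by (simp add: algebra_simps)
  also have "E + G = Abs_fps (\<lambda>n. \<Sum>i\<in>insert j A. x i ^ Suc n)"
    using insert.hyps by (intro fps_ext) (simp add: E_def G_def)
  finally show ?case
    using insert.hyps by (simp add: P_def L_def)
qed

text \<open>Comparing coefficients of T^(k-1) in the logarithmic derivative writes k times the k-th
  coefficient as a combination of the power sums of exponents 1 to k. The factor k must be
  invertible in the field.\<close>

lemma coeff_prod_linear_eq_0:
  fixes x :: "'a \<Rightarrow> 'k::field"
  assumes "finite A" and "\<And>k. k \<in> {1..m} \<Longrightarrow> (\<Sum>i\<in>A. x i ^ k) = 0"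
    and "k \<in> {1..m}" and "of_nat k \<noteq> (0::'k)"
  shows "coeff (\<Prod>i\<in>A. [:1, - x i:]) k = 0"
proof -
  define P where "P = (\<Prod>i\<in>A. [:1, - x i:])"
  have lin: "fps_of_poly [:1, - x i:] = 1 - fps_const (x i) * fps_X" for i
    by (simp add: fps_of_poly_linear')
  have P: "fps_of_poly P = (\<Prod>i\<in>A. 1 - fps_const (x i) * fps_X)"
    by (simp add: P_def fps_of_poly_prod lin)
  have "fps_deriv (fps_of_poly P) $ (k - 1) = 0"
    unfolding P fps_deriv_prod_linear[OF assms(1)] fps_mult_nth
  proof (intro sum.neutral ballI)
    fix l assume "l \<in> {0..k - 1}"
    hence "Suc (k - 1 - l) \<in> {1..m}" using assms(3) by auto
    from assms(2)[OF this]
    show "(- (\<Prod>i\<in>A. 1 - fps_const (x i) * fps_X)) $ l *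
        Abs_fps (\<lambda>n. \<Sum>i\<in>A. x i ^ Suc n) $ (k - 1 - l) = 0" by simp
  qed
  moreover have "k = Suc (k - 1)" using assms(3) by simp
  ultimately have "of_nat k * coeff P k = 0"
    by (metis Suc_eq_plus1 fps_deriv_nth fps_of_poly_nth)
  thus ?thesis using assms(4) by (simp add: P_def)
qed

lemma Frobenius_of_power_sums_eq_0:
  fixes x :: "'a \<Rightarrow> 'k::field"
  assumes "finite A" "card A = p - 1" "CHAR('k) = p" "p \<ge> 3"
    and "\<And>k. k \<in> {1..p - 3} \<Longrightarrow> (\<Sum>i\<in>A. x i ^ k) = 0"
  obtains a b where "\<And>i. i \<in> A \<Longrightarrow> x i ^ p = a * x i ^ 2 + b * x i"
proof -
  define P where "P = (\<Prod>i\<in>A. [:1, - x i:])"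
  have deg: "degree P \<le> p - 1"
  proof -
    have "degree P \<le> (\<Sum>i\<in>A. degree [:1, - x i:])"
      unfolding P_def using degree_prod_sum_le[OF assms(1), of "\<lambda>i. [:1, - x i:]"]
      by (simp only: o_def)
    also have "\<dots> \<le> (\<Sum>i\<in>A. 1)" by (intro sum_mono) simp
    finally show ?thesis using assms(2) by simp
  qed
  have c0: "coeff P 0 = 1"
    unfolding P_def by (simp add: poly_prod flip: poly_0_coeff_0)
  have ck: "coeff P k = 0" if "k \<in> {1..p - 3}" for k
  proof -
    \<comment> \<open>Here 0 < k < p, so the characteristic does not divide k.\<close>
    have "of_nat k \<noteq> (0::'k)"
      using that assms(3,4) by (auto simp: of_nat_eq_0_iff_char_dvd dest: dvd_imp_le)
    thus ?thesis unfolding P_def using coeff_prod_linear_eq_0[OF assms(1,5)] that by blast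
  qed
  have poly: "poly P y = 1 + coeff P (p - 2) * y ^ (p - 2) + coeff P (p - 1) * y ^ (p - 1)" for y
  proof -
    have "poly P y = (\<Sum>k\<le>p - 1. coeff P k * y ^ k)"
      by (rule poly_eq_sum_coeff) (use deg in auto)
    also have "\<dots> = (\<Sum>k\<in>{0, p - 2, p - 1}. coeff P k * y ^ k)"
    proof (rule sum.mono_neutral_right)
      show "\<forall>k\<in>{..p - 1} - {0, p - 2, p - 1}. coeff P k * y ^ k = 0"
      proof
        fix k assume "k \<in> {..p - 1} - {0, p - 2, p - 1}"
        hence "k \<in> {1..p - 3}" by auto
        thus "coeff P k * y ^ k = 0" using ck by simp
      qed
    qed auto
    finally show ?thesis using assms(4) c0 by (simp add: add.assoc)
  qed
  have "x i ^ p = - coeff P (p - 2) * x i ^ 2 + - coeff P (p - 1) * x i" if "i \<in> A" for i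
  proof (cases "x i = 0")
    case True
    thus ?thesis using assms(4) by simp
  next
    case False
    have "poly P (inverse (x i)) = 0"
      using that assms(1) False by (auto simp: P_def poly_prod intro!: bexI[of _ i])
    \<comment> \<open>Multiplying by \<open>x i ^ p\<close> rather than \<open>x i ^ (p - 1)\<close>
      gives a relation without constant term, which zero coordinates satisfy as well.\<close>
    hence "x i ^ p * (1 + coeff P (p - 2) * inverse (x i) ^ (p - 2)
        + coeff P (p - 1) * inverse (x i) ^ (p - 1)) = 0"
      by (simp add: poly)
    moreover have "x i ^ p * inverse (x i) ^ (p - 2) = x i ^ 2"
      using False assms(4) by (simp add: power_inverse power_diff field_simps)
    moreover have "x i ^ p * inverse (x i) ^ (p - 1) = x i"
      using False assms(4) by (simp add: power_inverse power_diff field_simps)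
    ultimately have "x i ^ p + coeff P (p - 2) * x i ^ 2 + coeff P (p - 1) * x i = 0"
      by (simp add: distrib_left mult.left_commute[of "x i ^ p"])
    thus ?thesis by (simp add: add_eq_0_iff2 algebra_simps)
  qed
  thus thesis by (rule that)
qed

lemma card_nonzero_values_gt:
  fixes x :: "'a \<Rightarrow> 'k::field"
  assumes A: "finite A" "card A < CHAR('k)"
    and sums: "\<And>k. k \<in> {1..m} \<Longrightarrow> (\<Sum>i\<in>A. x i ^ k) = 0"
    and j: "j \<in> A" "x j \<noteq> 0"
  shows "m < card (x ` A - {0})"
proof (rule ccontr)
  assume contra: "\<not> m < card (x ` A - {0})"
  define D where "D = x ` A - {0}"
  \<comment> \<open>\<open>g\<close> vanishes at every coordinate value except \<open>x j\<close>.
    Its factor T disposes of zero coordinates and also removes the constant term, so only power sums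
    of positive exponent enter the sum of \<open>g\<close> over the coordinates.\<close>
  define g where "g = [:0, 1:] * (\<Prod>y\<in>D - {x j}. [:- y, 1:])"
  have fin: "finite D" and jD: "x j \<in> D" using A j by (auto simp: D_def)
  have deg: "degree g \<le> m"
  proof -
    have "degree (\<Prod>y\<in>D - {x j}. [:- y, 1:]) \<le> (\<Sum>y\<in>D - {x j}. degree [:- y, 1:])"
      using degree_prod_sum_le[of "D - {x j}" "\<lambda>y. [:- y, 1:]"] fin by (simp only: o_def finite_Diff)
    hence "degree g \<le> 1 + card (D - {x j})"
      unfolding g_def by (intro order.trans[OF degree_mult_le]) simp
    also have "\<dots> = card D" using fin jD by (metis card.remove plus_1_eq_Suc)
    finally show ?thesis using contra by (simp add: D_def)
  qed
  have g0: "coeff g 0 = 0" by (simp add: g_def)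
  have "(\<Sum>i\<in>A. poly g (x i)) = (\<Sum>i\<in>A. \<Sum>k\<le>m. coeff g k * x i ^ k)"
    using deg by (intro sum.cong refl poly_eq_sum_coeff) auto
  also have "\<dots> = (\<Sum>k\<le>m. coeff g k * (\<Sum>i\<in>A. x i ^ k))"
    by (subst sum.swap) (simp add: sum_distrib_left)
  also have "\<dots> = 0"
  proof (intro sum.neutral ballI)
    fix k assume "k \<in> {..m}"
    thus "coeff g k * (\<Sum>i\<in>A. x i ^ k) = 0"
      using sums[of k] g0 by (cases "k = 0") auto
  qed
  finally have "(\<Sum>i\<in>A. poly g (x i)) = 0" .
  moreover have "(\<Sum>i\<in>A. poly g (x i)) = (\<Sum>i\<in>{i\<in>A. x i = x j}. poly g (x i))"
    using fin by (intro sum.mono_neutral_right) (auto simp: g_def poly_prod D_def A)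
  moreover have "\<dots> = of_nat (card {i\<in>A. x i = x j}) * poly g (x j)" by simp
  \<comment> \<open>The multiplicity of the value \<open>x j\<close> is positive and below the
    characteristic, so it does not vanish in the field.\<close>
  moreover have "of_nat (card {i\<in>A. x i = x j}) \<noteq> (0::'k)"
  proof -
    have "card {i\<in>A. x i = x j} \<le> card A" using A by (intro card_mono) auto
    moreover have "card {i\<in>A. x i = x j} > 0" using A j by (auto simp: card_gt_0_iff)
    ultimately show ?thesis
      using A(2) by (auto simp: of_nat_eq_0_iff_char_dvd dest: dvd_imp_le)
  qed
  moreover have "poly g (x j) \<noteq> 0"
    using fin j by (auto simp: g_def poly_prod)
  ultimately show False by simp
qed

lemma Frobenius_coeff_eq_0:
  fixes S :: "'k::field set"
  assumes p: "Factorial_Ring.prime p" "CHAR('k) = p"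
    and rel: "\<And>y. y \<in> S \<Longrightarrow> y ^ p = a * y ^ 2 + b * y"
    and fixed: "\<And>y. y \<in> S \<Longrightarrow> y ^ (p ^ 2) = y"
    and card: "card (S - {0}) > 3"
  shows "a = 0"
proof (rule ccontr)
  assume a: "a \<noteq> 0"
  \<comment> \<open>\<open>y * poly h y\<close> is \<open>y^(p^2) - y\<close>, computed by applying \<open>rel\<close> twice\<close>
  define h where "h = [:b ^ (p + 1) - 1, a ^ p * b ^ 2 + b ^ p * a, 2 * a ^ (p + 1) * b, a ^ (p + 2):]"
  \<comment> \<open>The leading coefficient \<open>a ^ (p + 2)\<close> is nonzero because
    \<open>a\<close> is, so at most three nonzero \<open>y\<close> can occur.\<close>
  have h0: "h \<noteq> 0" and deg: "degree h = 3" using a by (auto simp: h_def)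
  have root: "poly h y = 0" if "y \<in> S - {0}" for y
  proof -
    have rel': "y ^ p = a * y ^ 2 + b * y" using rel that by simp
    have "y = (y ^ p) ^ p" using fixed that by (simp add: power_mult[symmetric] power2_eq_square)
    also have "\<dots> = (a * y ^ 2) ^ p + (b * y) ^ p"
      unfolding rel' using p by (simp add: freshmans_dream)
    also have "\<dots> = a ^ p * (y ^ p) ^ 2 + b ^ p * y ^ p"
      by (simp add: power_mult_distrib flip: power_mult) (simp add: mult.commute)
    also have "\<dots> = y * (1 + poly h y)"
      unfolding rel' by (simp add: h_def algebra_simps power2_eq_square)
    finally show ?thesis using that by (simp add: algebra_simps)
  qed
  have "card (S - {0}) \<le> card {y. poly h y = 0}"
    using root h0 by (intro card_mono poly_roots_finite) auto
  also have "\<dots> \<le> 3" using card_poly_roots_bound[OF h0] deg by simp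
  finally show False using card by simp
qed

lemma PG_mono: "F \<subseteq> F' \<Longrightarrow> PG n F \<subseteq> PG n F'"
  unfolding PG_def hom_coords_def by (intro image_mono) auto

lemma proj_point_scale:
  assumes "c \<noteq> 0"
  shows "proj_point (\<lambda>i. c * x i) = proj_point x"
proof -
  have "\<exists>d. d \<noteq> 0 \<and> (\<lambda>i. e * x i) = (\<lambda>i. d * (c * x i))" if "e \<noteq> 0" for e
    using that assms by (intro exI[of _ "e / c"]) auto
  thus ?thesis
    unfolding proj_point_def using assms
    by (auto simp: mult.assoc[symmetric]) (metis mult_eq_0_iff)+
qed

theorem theorem8p5:
  fixes p :: nat and V :: "(nat \<Rightarrow> 'f::field alg_closure) set set"
  assumes "Factorial_Ring.prime p" and "p \<ge> 7"
    and "CARD('f) = p"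
    and "V = power_sum_curve p"
  shows "V \<inter> PG (p - 2) (GF (p ^ 2)) = V \<inter> PG (p - 2) (GF p)"
proof -
  have char: "CHAR('f alg_closure) = p"
    using CHAR_alg_closure_prime_field assms by metis
  have Fp: "(GF p :: 'f alg_closure set) = {x. x ^ p = x}"
    using GF_prime_power(3)[OF assms(1) char, of 1] by simp
  have Fp2: "(GF (p ^ 2) :: 'f alg_closure set) = {x. x ^ (p ^ 2) = x}"
    using GF_prime_power(3)[OF assms(1) char, of 2] by simp
  have idx: "{1..p - 2 + 1} = {1..p - 1}" using assms(2) by auto
  have "Q \<in> PG (p - 2) (GF p)" if V: "Q \<in> V" and "Q \<in> PG (p - 2) (GF (p ^ 2))" for Q
  proof -
    obtain x where x: "x \<in> hom_coords (p - 2) (GF (p ^ 2))" and Q: "Q = proj_point x"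
      using \<open>Q \<in> PG (p - 2) (GF (p ^ 2))\<close> by (auto simp: PG_def)
    have "x \<in> hom_coords (p - 2) UNIV" using x by (auto simp: hom_coords_def)
    hence sums: "(\<Sum>i\<in>{1..p - 1}. x i ^ k) = 0" if "k \<in> {1..p - 3}" for k
      using V that proj_point_mem_power_sum_curve[of x p] unfolding assms(4) Q by blast
    obtain j where j: "j \<in> {1..p - 1}" "x j \<noteq> 0"
      using x unfolding hom_coords_def idx by blast
    obtain a b where ab: "x i ^ p = a * x i ^ 2 + b * x i" if "i \<in> {1..p - 1}" for i
      using Frobenius_of_power_sums_eq_0[of "{1..p - 1}" p x] sums char assms(2) by auto
    \<comment> \<open>Since p \<ge> 7, this bound exceeds the three nonzero values that are possible
      when \<open>a\<close> is nonzero.\<close>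
    have "p - 3 < card (x ` {1..p - 1} - {0})"
      using card_nonzero_values_gt[of "{1..p - 1}" "p - 3" x j] sums j char assms(2) by simp
    moreover have "y ^ (p ^ 2) = y" if "y \<in> x ` {1..p - 1}" for y
      using x that unfolding hom_coords_def idx Fp2 by auto
    ultimately have "a = 0"
      using assms(2) ab
      by (intro Frobenius_coeff_eq_0[OF assms(1) char, of "x ` {1..p - 1}" a b]) auto
    hence b: "x i ^ p = b * x i" if "i \<in> {1..p - 1}" for i using ab that by simp
    have "b \<noteq> 0" using b[OF j(1)] j(2) by auto
    \<comment> \<open>Normalising the j-th coordinate to 1 cancels \<open>b\<close>: the p-th power
      of x_i / x_j is (b x_i) / (b x_j).\<close>
    define z where "z = (\<lambda>i. inverse (x j) * x i)"
    have "z i ^ p = z i" if "i \<in> {1..p - 1}" for i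
      using b[OF that] b[OF j(1)] j(2) \<open>b \<noteq> 0\<close>
      by (simp add: z_def power_mult_distrib power_inverse)
    hence "z \<in> hom_coords (p - 2) (GF p)"
      using x j unfolding hom_coords_def idx Fp by (auto simp: z_def)
    moreover have "Q = proj_point z"
      unfolding Q z_def using proj_point_scale[of "inverse (x j)" x] j(2) by simp
    ultimately show ?thesis by (auto simp: PG_def)
  qed
  \<comment> \<open>The converse inclusion of point sets: an element fixed by Frobenius is fixed by
    its square.\<close>
  moreover have "(GF p :: 'f alg_closure set) \<subseteq> GF (p ^ 2)"
    unfolding Fp Fp2 by (auto simp: power2_eq_square power_mult)
  ultimately show ?thesis using PG_mono by blast
qed

end
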